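(* Let $n>1$, let $A\in\mathbb{R}^{n\times n}$, and let $L_A$ be the linear transformation on the space $\mathcal{S}^n$ of $n\times n$ real symmetric matrices defined by $L_A(X)=AX+XA^T$. Then: (1) $L_A$ is space-irreducible if and only if for every orthogonal matrix $U\in\mathbb{R}^{n\times n}$, the matrix $U^TAU$ is irreducible. (2) $L_A$ is space-irreducible if and only if $n=2$ and $A$ is a real matrix with a non-real pair of complex conjugate eigenvalues.
   Context: $\mathcal{S}^n$ carries the inner product $\langle X,Y\rangle=\operatorname{tr}(XY)$ and the Jordan product $X\circ Y=\frac{XY+YX}{2}$; its symmetric cone is the cone $\mathcal{S}^n_+$ of positive semidefinite matrices. A face of a cone $K$ is a convex cone $F\subseteq K$ such that if $a\in F$ and $a=b+c$ with $b,c\in K$, then $b,c\in F$. A linear transformation $L$ on $\mathcal{S}^n$ is space-irreducible (relative to $K=\mathcal{S}^n_+$) if whenever $F$ is a face of $K$ with $L(F-F)\subseteq F-F$, then $F=\{0\}$ or $F=K$. Equivalently: for every $C\in\mathcal{S}^n$ with $C^2=C$, if $L(V(C,1))\subseteq V(C,1)$, where $V(C,1)=\{X\in\mathcal{S}^n:X\circ C=X\}$, then $C=0$ or $C=I$. A real square matrix is irreducible if no simultaneous permutation of its rows and columns produces a $2\times 2$ block matrix in which the diagonal blocks are square (and nonempty) and the southwest (equivalently, northeast) block is zero. *)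

theory Defs
  imports "HOL-Analysis.Analysis"
begin

definition sym_mats :: "(real ^ 'n ^ 'n) set" where
  "sym_mats = {X. transpose X = X}"

definition psd_cone :: "(real ^ 'n ^ 'n) set" where
  "psd_cone = {X \<in> sym_mats. \<forall>v. 0 \<le> v \<bullet> (X *v v)}"

text \<open>
  The library's \<^const>\<open>face_of\<close> does not require a face to be a cone (or nonempty), so faces
  of cones are defined separately.  A \<^const>\<open>convex_cone\<close> is nonempty and contains 0.
\<close>

definition cone_face :: "'a::real_vector set \<Rightarrow> 'a set \<Rightarrow> bool" where
  "cone_face F K \<longleftrightarrow> convex_cone F \<and> F \<subseteq> K \<and>
     (\<forall>a\<in>F. \<forall>b\<in>K. \<forall>c\<in>K. a = b + c \<longrightarrow> b \<in> F \<and> c \<in> F)"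

text \<open>
  The algebraic difference \<open>F - F\<close>, not the set difference written \<open>-\<close>.
\<close>

definition diff_set :: "'a::real_vector set \<Rightarrow> 'a set" where
  "diff_set F = {x - y | x y. x \<in> F \<and> y \<in> F}"

text \<open>
  For \<open>F \<subseteq> K\<close>, only the values of \<open>L\<close> on \<^term>\<open>diff_set K\<close> matter; for \<^const>\<open>psd_cone\<close> these
  lie in \<^const>\<open>sym_mats\<close>, so \<open>L\<close> may be given as a map on all square matrices.
\<close>

definition space_irreducible :: "'a::real_vector set \<Rightarrow> ('a \<Rightarrow> 'a) \<Rightarrow> bool" where
  "space_irreducible K L \<longleftrightarrow>
     (\<forall>F. cone_face F K \<and> L ` diff_set F \<subseteq> diff_set F \<longrightarrow> F = {0} \<or> F = K)"

definition lyapunov :: "real ^ 'n ^ 'n \<Rightarrow> real ^ 'n ^ 'n \<Rightarrow> real ^ 'n ^ 'n" where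
  "lyapunov A X = A ** X + X ** transpose A"

lemma linear_lyapunov: "linear (lyapunov A)"
  by (rule linearI)
     (simp_all add: lyapunov_def matrix_matrix_mult_def vec_eq_iff sum.distrib
        sum_distrib_left algebra_simps)

lemma lyapunov_sym_mats: "X \<in> sym_mats \<Longrightarrow> lyapunov A X \<in> sym_mats"
  by (simp add: sym_mats_def lyapunov_def transpose_def matrix_matrix_mult_def vec_eq_iff)
     (simp add: add.commute mult.commute)

text \<open>
  Since the index type \<open>'n\<close> carries no order, a simultaneous permutation of rows and columns is
  an enumeration \<open>p\<close> of the indices as \<open>0, ..., CARD('n) - 1\<close>; the diagonal blocks are
  \<open>k \<times> k\<close> and \<open>(CARD('n) - k) \<times> (CARD('n) - k)\<close>, and the southwest block has rows \<open>i \<ge> k\<close> and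
  columns \<open>j < k\<close>.
\<close>

definition irreducible_matrix :: "real ^ 'n ^ 'n \<Rightarrow> bool" where
  "irreducible_matrix A \<longleftrightarrow>
     \<not> (\<exists>(p :: nat \<Rightarrow> 'n) k. bij_betw p {..<CARD('n)} UNIV \<and> 0 < k \<and> k < CARD('n) \<and>
          (\<forall>i\<in>{k..<CARD('n)}. \<forall>j\<in>{..<k}. A $ p i $ p j = 0))"

definition complex_eigenvalue :: "real ^ 'n ^ 'n \<Rightarrow> complex \<Rightarrow> bool" where
  "complex_eigenvalue A z \<longleftrightarrow>
     (\<exists>v :: complex ^ 'n. v \<noteq> 0 \<and> (\<chi> i j. complex_of_real (A $ i $ j)) *v v = z *s v)"

end

theory Submission
  imports Defs "HOL-Computational_Algebra.Fundamental_Theorem_Algebra"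
begin

text \<open>
  All three conditions say that \<open>A\<close> has no invariant subspace other than \<open>0\<close> and
  \<open>\<real>\<^sup>n\<close>; taking orthogonal complements, this holds for \<open>A\<close> if and only if it holds for \<open>A\<^sup>T\<close>
  (\<open>has_invariant_subspace_transpose\<close>).

  The faces of the semidefinite cone are the sets \<open>F\<^sub>N\<close> of all positive semidefinite \<open>X\<close> that
  vanish on a subspace \<open>N\<close>. If \<open>A\<^sup>T N \<subseteq> N\<close>, the span of \<open>F\<^sub>N\<close> is invariant under \<open>L\<^sub>A\<close>, because
  \<open>L\<^sub>A(X) = (I + A) X (I + A)\<^sup>T - (X + A X A\<^sup>T)\<close> is a difference of elements of \<open>F\<^sub>N\<close> whenever
  \<open>X \<in> F\<^sub>N\<close> (\<open>lyapunov_kernel_face\<close>). Conversely, let \<open>F\<close> be a face with invariant span and \<open>N\<close>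
  the common kernel of its elements. For \<open>v \<in> N\<close> and \<open>X \<in> F\<close>, \<open>L\<^sub>A(X)\<close> vanishes at \<open>v\<close>, which
  reads \<open>X A\<^sup>T v = 0\<close>; so \<open>N\<close> is invariant under \<open>A\<^sup>T\<close>. If \<open>N = \<real>\<^sup>n\<close> then \<open>F = 0\<close>; if \<open>N = 0\<close>
  then \<open>F\<close> contains a positive definite matrix (\<open>face_common_kernel\<close>), a multiple of which
  dominates any given semidefinite matrix (\<open>positive_definite_dominates\<close>), so \<open>F\<close> is the
  whole cone.

  For the orthogonal similarities, an orthonormal basis of an invariant subspace, extended to one
  of \<open>\<real>\<^sup>n\<close>, gives the columns of a \<open>U\<close> for which \<open>U\<^sup>T A U\<close> is block triangular, and the leading
  columns of any such \<open>U\<close> span an invariant subspace.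

  Finally, if \<open>x + \<i> y\<close> is a complex eigenvector of \<open>A\<close>, the span of \<open>x\<close> and \<open>y\<close> is invariant,
  so without proper invariant subspaces \<open>n \<le> 2\<close>, and the eigenvalue is not real because a real
  one would have an invariant line (\<open>no_invariant_imp_nonreal_eigenvalue\<close>). When \<open>n = 2\<close> a proper
  invariant subspace is a line \<open>W\<close>. It and its orthogonal complement give real eigenvalues of \<open>A\<close>
  and of \<open>A\<^sup>T\<close>, which together rule out a non-real one (\<open>nonreal_eigenvalue_imp_no_invariant\<close>).
\<close>

definition has_invariant_subspace :: "real ^ 'n ^ 'n \<Rightarrow> bool" where
  "has_invariant_subspace A \<longleftrightarrow>
     (\<exists>W. subspace W \<and> W \<noteq> {0} \<and> W \<noteq> UNIV \<and> (\<forall>w\<in>W. A *v w \<in> W))"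

section \<open>Invariant subspaces and transposition\<close>

text \<open>
  This rewrite to a row-vector product would take expressions with \<^term>\<open>transpose A *v v\<close> out of
  the form in which adjoints and invariance are expressed below.
\<close>

declare transpose_matrix_vector [simp del]

lemma inner_transpose_mult:
  fixes A :: "real ^ 'n ^ 'm"
  shows "x \<bullet> (A *v y) = (transpose A *v x) \<bullet> y"
  by (metis dot_lmul_matrix transpose_matrix_vector)

lemma inner_sym_mats:
  assumes "X \<in> sym_mats"
  shows "x \<bullet> (X *v y) = (X *v x) \<bullet> y"
  using assms inner_transpose_mult[of x X y] by (simp add: sym_mats_def)

lemma orthogonal_comp_proper:
  fixes W :: "'a::euclidean_space set"
  assumes "subspace W" "W \<noteq> {0}" "W \<noteq> UNIV"
  shows "W\<^sup>\<bottom> \<noteq> {0}" "W\<^sup>\<bottom> \<noteq> UNIV"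
  using orthogonal_comp_self[OF assms(1)] assms(2,3) orthogonal_comp_null orthogonal_comp_UNIV
  by metis+

lemma orthogonal_comp_invariant:
  fixes A :: "real ^ 'n ^ 'n"
  assumes "\<forall>w\<in>W. A *v w \<in> W" "v \<in> W\<^sup>\<bottom>"
  shows "transpose A *v v \<in> W\<^sup>\<bottom>"
proof -
  have "w \<bullet> (transpose A *v v) = (A *v w) \<bullet> v" for w
    by (metis inner_commute inner_transpose_mult)
  then show ?thesis
    using assms by (simp add: orthogonal_comp_def orthogonal_def)
qed

lemma has_invariant_subspace_transpose:
  "has_invariant_subspace (transpose A) \<longleftrightarrow> has_invariant_subspace A"
proof -
  have *: "has_invariant_subspace (transpose B)" if B: "has_invariant_subspace B"
    for B :: "real ^ 'n ^ 'n"
  proof -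
    obtain W where W: "subspace W" "W \<noteq> {0}" "W \<noteq> UNIV" "\<forall>w\<in>W. B *v w \<in> W"
      using B unfolding has_invariant_subspace_def by blast
    then show ?thesis
      unfolding has_invariant_subspace_def
      using subspace_orthogonal_comp orthogonal_comp_proper[OF W(1-3)] orthogonal_comp_invariant[OF W(4)]
      by blast
  qed
  show ?thesis using *[of A] *[of "transpose A"] by auto
qed

section \<open>Faces of the positive semidefinite cone\<close>

text \<open>
  The quadratic form is nonnegative along \<open>v + t w\<close> with \<open>w = X v\<close>; there it equals
  \<open>2 t \<parallel>w\<parallel>\<^sup>2 + t\<^sup>2 (w \<bullet> X w)\<close>, which is negative for small negative \<open>t\<close> unless \<open>w = 0\<close>.
\<close>

lemma psd_kernel:
  assumes X: "X \<in> psd_cone" and v: "v \<bullet> (X *v v) = 0"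
  shows "X *v v = 0"
proof (rule ccontr)
  define w where "w = X *v v"
  define a where "a = w \<bullet> w"
  define c where "c = w \<bullet> (X *v w)"
  assume "X *v v \<noteq> 0"
  then have a: "a > 0" by (simp add: a_def w_def)
  have sym: "X \<in> sym_mats" and pos: "\<And>u. 0 \<le> u \<bullet> (X *v u)"
    using X by (auto simp: psd_cone_def)
  have c: "c \<ge> 0" using pos by (simp add: c_def)
  have q: "0 \<le> 2 * t * a + t\<^sup>2 * c" for t
  proof -
    have vw: "v \<bullet> (X *v w) = a"
      using inner_sym_mats[OF sym, of v w] by (simp add: a_def w_def)
    have "0 \<le> (v + t *\<^sub>R w) \<bullet> (X *v (v + t *\<^sub>R w))" by (rule pos)
    also have "\<dots> = 2 * t * a + t\<^sup>2 * c"
      using v vw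
      by (simp add: matrix_vector_right_distrib matrix_vector_mult_scaleR inner_add_left
          inner_add_right c_def a_def w_def[symmetric] power2_eq_square algebra_simps)
    finally show ?thesis .
  qed
  \<comment> \<open>This choice of \<open>t\<close> also covers \<open>c = 0\<close>.\<close>
  have "2 * (- (a / (c + 1))) * a + (- (a / (c + 1)))\<^sup>2 * c = - (a\<^sup>2 * (c + 2)) / (c + 1)\<^sup>2"
    using c by (simp add: divide_simps) (simp add: power2_eq_square algebra_simps)
  also have "\<dots> < 0" using a c by (simp add: divide_neg_pos)
  finally show False using q[of "- (a / (c + 1))"] by linarith
qed

lemma psd_cone_add:
  "X \<in> psd_cone \<Longrightarrow> Y \<in> psd_cone \<Longrightarrow> X + Y \<in> psd_cone"
  by (auto simp: psd_cone_def sym_mats_def transpose_def vec_eq_iff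
      matrix_vector_mult_add_rdistrib inner_add_right)

lemma psd_cone_scaleR:
  "X \<in> psd_cone \<Longrightarrow> 0 \<le> c \<Longrightarrow> c *\<^sub>R X \<in> psd_cone"
  by (auto simp: psd_cone_def sym_mats_def transpose_def vec_eq_iff
      scaleR_matrix_vector_assoc[symmetric])

lemma zero_in_psd_cone: "0 \<in> psd_cone"
  by (auto simp: psd_cone_def sym_mats_def transpose_def vec_eq_iff)

lemma psd_cone_congruence:
  assumes X: "X \<in> psd_cone"
  shows "B ** X ** transpose B \<in> psd_cone"
proof -
  have sym: "transpose X = X" and pos: "\<And>u. 0 \<le> u \<bullet> (X *v u)"
    using X by (auto simp: psd_cone_def sym_mats_def)
  have "transpose (B ** X ** transpose B) = B ** X ** transpose B"
    by (simp add: matrix_transpose_mul matrix_mul_assoc sym)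
  moreover have "0 \<le> v \<bullet> (B ** X ** transpose B *v v)" for v
    using pos[of "transpose B *v v"] inner_transpose_mult[of v B "X *v (transpose B *v v)"]
    by (metis matrix_vector_mul_assoc)
  ultimately show ?thesis
    by (simp add: psd_cone_def sym_mats_def)
qed

definition kernel_face :: "(real ^ 'n) set \<Rightarrow> (real ^ 'n ^ 'n) set" where
  "kernel_face N = {X \<in> psd_cone. \<forall>v\<in>N. X *v v = 0}"

text \<open>
  Since \<open>X v = 0\<close> is equivalent to \<open>v \<bullet> X v = 0\<close> on the cone, and the values of the form of two
  summands are nonnegative, they vanish as soon as their sum does.
\<close>

lemma cone_face_kernel_face: "cone_face (kernel_face N) psd_cone"
  for N :: "(real ^ 'n) set"
  unfolding cone_face_def
proof (intro conjI ballI impI)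
  show "convex_cone (kernel_face N)"
    by (auto simp: convex_cone_iff kernel_face_def zero_in_psd_cone psd_cone_add psd_cone_scaleR
        matrix_vector_mult_add_rdistrib scaleR_matrix_vector_assoc[symmetric])
  show "kernel_face N \<subseteq> psd_cone" by (auto simp: kernel_face_def)
  fix a b c :: "real ^ 'n ^ 'n"
  assume a: "a \<in> kernel_face N" and b: "b \<in> psd_cone" and c: "c \<in> psd_cone" and abc: "a = b + c"
  have "b *v v = 0 \<and> c *v v = 0" if "v \<in> N" for v
  proof -
    have "a *v v = 0" using a that by (simp add: kernel_face_def)
    then have "v \<bullet> (b *v v) + v \<bullet> (c *v v) = 0"
      by (metis abc inner_add_right inner_zero_right matrix_vector_mult_add_rdistrib)
    moreover have "0 \<le> v \<bullet> (b *v v)" "0 \<le> v \<bullet> (c *v v)" using b c by (auto simp: psd_cone_def)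
    ultimately have "v \<bullet> (b *v v) = 0" "v \<bullet> (c *v v) = 0" by linarith+
    then show ?thesis using psd_kernel b c by blast
  qed
  then show "b \<in> kernel_face N" "c \<in> kernel_face N"
    using b c by (auto simp: kernel_face_def)
qed

lemma matrix_matrix_mult_add_rdistrib:
  fixes A :: "'a::semiring_1 ^ 'n ^ 'm"
  shows "(A + B) ** C = A ** C + B ** C"
  by (simp add: matrix_matrix_mult_def vec_eq_iff distrib_right sum.distrib)

text \<open>
  This exhibits the Lyapunov operator as a difference of maps that preserve the semidefinite cone,
  which avoids decomposing a symmetric matrix into semidefinite parts.
\<close>

lemma lyapunov_congruence:
  "lyapunov A X = (mat 1 + A) ** X ** transpose (mat 1 + A) - (X + A ** X ** transpose A)"
proof -
  have t: "transpose (mat 1 + A) = mat 1 + transpose A"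
    by (simp add: transpose_def vec_eq_iff mat_def)
  show ?thesis
    unfolding t lyapunov_def
    by (simp add: matrix_add_ldistrib matrix_matrix_mult_add_rdistrib)
qed

lemma lyapunov_kernel_face:
  assumes N: "\<forall>v\<in>N. transpose A *v v \<in> N" and sub: "subspace N"
  shows "lyapunov A ` diff_set (kernel_face N) \<subseteq> diff_set (kernel_face N)"
proof
  have cong: "B ** X ** transpose B \<in> kernel_face N"
    if "X \<in> kernel_face N" "\<forall>v\<in>N. transpose B *v v \<in> N" for B X
    using that by (auto simp: kernel_face_def psd_cone_congruence matrix_vector_mul_assoc[symmetric])
  have add: "X + Y \<in> kernel_face N" if "X \<in> kernel_face N" "Y \<in> kernel_face N" for X Y
    using that cone_face_kernel_face[of N] unfolding cone_face_def by (blast intro: convex_cone_add)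
  have t: "transpose (mat 1 + A) = mat 1 + transpose A"
    by (simp add: transpose_def vec_eq_iff mat_def)
  have N1: "\<forall>v\<in>N. transpose (mat 1 + A) *v v \<in> N"
    using N sub by (simp add: t matrix_vector_mult_add_rdistrib subspace_add)
  fix Z assume "Z \<in> lyapunov A ` diff_set (kernel_face N)"
  then obtain X Y where XY: "X \<in> kernel_face N" "Y \<in> kernel_face N"
    and Z: "Z = lyapunov A (X - Y)"
    by (auto simp: diff_set_def)
  define P where "P X = (mat 1 + A) ** X ** transpose (mat 1 + A)" for X
  define Q where "Q X = X + A ** X ** transpose A" for X
  have L: "lyapunov A X = P X - Q X" for X
    unfolding P_def Q_def by (rule lyapunov_congruence)
  have "Z = lyapunov A X - lyapunov A Y"
    unfolding Z by (rule linear_diff[OF linear_lyapunov])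
  then have "Z = (P X + Q Y) - (Q X + P Y)"
    by (simp add: L)
  moreover have "P X + Q Y \<in> kernel_face N" "Q X + P Y \<in> kernel_face N"
    unfolding P_def Q_def by (intro add cong XY N N1)+
  ultimately show "Z \<in> diff_set (kernel_face N)"
    unfolding diff_set_def by blast
qed

lemma space_irreducible_imp_no_invariant:
  fixes A :: "real ^ 'n ^ 'n"
  assumes irr: "space_irreducible psd_cone (lyapunov A)"
  shows "\<not> has_invariant_subspace (transpose A)"
proof
  assume "has_invariant_subspace (transpose A)"
  then obtain N where N: "subspace N" "N \<noteq> {0}" "N \<noteq> UNIV" "\<forall>v\<in>N. transpose A *v v \<in> N"
    unfolding has_invariant_subspace_def by blast
  \<comment> \<open>The face is nontrivial: the identity is outside it, and \<open>w w\<^sup>T\<close> with \<open>w\<close> orthogonal to \<open>N\<close> inside.\<close>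
  have "kernel_face N = {0} \<or> kernel_face N = psd_cone"
    using irr cone_face_kernel_face lyapunov_kernel_face[OF N(4,1)]
    unfolding space_irreducible_def by blast
  moreover have "kernel_face N \<noteq> psd_cone"
  proof -
    obtain v where "v \<in> N" "v \<noteq> 0" using N(1,2) subspace_0 by blast
    then have "mat 1 \<notin> kernel_face N" by (auto simp: kernel_face_def)
    moreover have "mat 1 \<in> psd_cone" by (simp add: psd_cone_def sym_mats_def)
    ultimately show ?thesis by blast
  qed
  moreover have "kernel_face N \<noteq> {0}"
  proof -
    obtain w where w: "w \<in> N\<^sup>\<bottom>" "w \<noteq> 0"
      using orthogonal_comp_proper[OF N(1-3)] subspace_0[OF subspace_orthogonal_comp] by blast
    define X :: "real ^ 'n ^ 'n" where "X = (\<chi> i j. w $ i * w $ j)"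
    have Xv: "X *v v = (w \<bullet> v) *\<^sub>R w" for v
      by (simp add: X_def matrix_vector_mult_def vec_eq_iff inner_vec_def sum_distrib_left
          sum_distrib_right algebra_simps)
    have "X \<in> psd_cone"
      by (auto simp: psd_cone_def Xv sym_mats_def inner_commute)
         (simp add: X_def transpose_def vec_eq_iff)
    moreover have "X *v v = 0" if "v \<in> N" for v
      using that w by (auto simp: Xv orthogonal_comp_def orthogonal_def inner_commute)
    ultimately have "X \<in> kernel_face N" by (simp add: kernel_face_def)
    moreover have "X \<noteq> 0"
      using Xv[of w] w by auto
    ultimately show ?thesis by blast
  qed
  ultimately show False by blast
qed

text \<open>
  On the compact unit sphere the form of \<open>X\<close> has a positive minimum \<open>m\<close> and that of \<open>Y\<close> a maximum
  \<open>M\<close>; then \<open>t = M / m\<close> works.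
\<close>

lemma positive_definite_dominates:
  fixes X Y :: "real ^ 'n ^ 'n"
  assumes X: "X \<in> psd_cone" and def: "\<And>v. X *v v = 0 \<Longrightarrow> v = 0" and Y: "Y \<in> psd_cone"
  obtains t where "0 \<le> t" "t *\<^sub>R X - Y \<in> psd_cone"
proof -
  define S :: "(real ^ 'n) set" where "S = sphere 0 1"
  have S: "compact S" "S \<noteq> {}"
    by (auto simp: S_def)
  have contX: "continuous_on S (\<lambda>v. v \<bullet> (X *v v))" and contY: "continuous_on S (\<lambda>v. v \<bullet> (Y *v v))"
    by (intro continuous_intros matrix_vector_mult_linear_continuous_on)+
  obtain x where x: "x \<in> S" "\<And>v. v \<in> S \<Longrightarrow> x \<bullet> (X *v x) \<le> v \<bullet> (X *v v)"
    using continuous_attains_inf[OF S contX] by blast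
  obtain y where y: "y \<in> S" "\<And>v. v \<in> S \<Longrightarrow> v \<bullet> (Y *v v) \<le> y \<bullet> (Y *v y)"
    using continuous_attains_sup[OF S contY] by blast
  define m where "m = x \<bullet> (X *v x)"
  define M where "M = y \<bullet> (Y *v y)"
  have "x \<noteq> 0" using x by (auto simp: S_def)
  then have m: "m > 0"
    using psd_kernel[OF X] def X unfolding m_def psd_cone_def
    by (metis (mono_tags, lifting) X mem_Collect_eq order_less_le psd_cone_def)
  have M: "M \<ge> 0" using Y by (simp add: M_def psd_cone_def)
  define t where "t = M / m"
  have t: "0 \<le> t" using m M by (simp add: t_def)
  have dom: "v \<bullet> (Y *v v) \<le> t * (v \<bullet> (X *v v))" for v
  proof (cases "v = 0")
    case False
    define u where "u = (1 / norm v) *\<^sub>R v"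
    have u: "u \<in> S" using False by (simp add: u_def S_def)
    have v: "v = norm v *\<^sub>R u" using False by (simp add: u_def)
    have "u \<bullet> (Y *v u) \<le> M" using y u by (simp add: M_def)
    also have "M = t * m" using m by (simp add: t_def)
    also have "t * m \<le> t * (u \<bullet> (X *v u))"
      using x(2)[OF u] t by (simp add: m_def mult_left_mono)
    finally have "(norm v)\<^sup>2 * (u \<bullet> (Y *v u)) \<le> (norm v)\<^sup>2 * (t * (u \<bullet> (X *v u)))"
      by (simp add: mult_left_mono)
    then show ?thesis
      by (subst (1 2) v, subst (1 2) v)
         (simp add: matrix_vector_mult_scaleR power2_eq_square algebra_simps)
  qed simp
  have "t *\<^sub>R X - Y \<in> psd_cone"
    using X Y dom
    by (auto simp: psd_cone_def sym_mats_def transpose_def vec_eq_iff inner_diff_right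
      matrix_vector_mult_diff_rdistrib scaleR_matrix_vector_assoc[symmetric])
  with t that show thesis by blast
qed

text \<open>
  The kernel of \<open>X + Y\<close> is the intersection of the kernels of \<open>X\<close> and \<open>Y\<close> on the cone, so an element
  of \<open>F\<close> whose kernel has least dimension cannot lose kernel by adding another element of \<open>F\<close>.
\<close>

lemma face_common_kernel:
  fixes F :: "(real ^ 'n ^ 'n) set"
  assumes F: "convex_cone F" "F \<subseteq> psd_cone"
  obtains X where "X \<in> F" "\<And>v. X *v v = 0 \<Longrightarrow> \<forall>Y\<in>F. Y *v v = 0"
proof -
  define ker where "ker X = {v. X *v v = 0}" for X :: "real ^ 'n ^ 'n"
  have sub: "subspace (ker X)" for X
    by (auto simp: ker_def subspace_def matrix_vector_right_distrib matrix_vector_mult_scaleR)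
  have "F \<noteq> {}" using F by (simp add: convex_cone_def)
  then obtain X where X: "X \<in> F" "\<And>Y. Y \<in> F \<Longrightarrow> dim (ker X) \<le> dim (ker Y)"
    using ex_has_least_nat[of "\<lambda>X. X \<in> F" _ "\<lambda>X. dim (ker X)"] by blast
  have "Y *v v = 0" if v: "X *v v = 0" and Y: "Y \<in> F" for v Y
  proof -
    have "X + Y \<in> F" using F X Y by (simp add: convex_cone_add)
    moreover have "ker (X + Y) \<subseteq> ker X \<inter> ker Y"
    proof
      fix u assume "u \<in> ker (X + Y)"
      then have "(X + Y) *v u = 0" by (simp add: ker_def)
      moreover have "X + Y \<in> kernel_face {u}"
        using calculation \<open>X + Y \<in> F\<close> F by (auto simp: kernel_face_def)
      ultimately have "X \<in> kernel_face {u}" "Y \<in> kernel_face {u}"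
        using cone_face_kernel_face[of "{u}"] X Y F unfolding cone_face_def by blast+
      then show "u \<in> ker X \<inter> ker Y" by (auto simp: kernel_face_def ker_def)
    qed
    ultimately have "ker (X + Y) = ker X"
      using X(2) sub subspace_dim_equal by (metis Int_subset_iff)
    with v have "v \<in> ker (X + Y)" by (simp add: ker_def)
    with \<open>ker (X + Y) \<subseteq> ker X \<inter> ker Y\<close> show ?thesis by (auto simp: ker_def)
  qed
  with X(1) that show thesis by blast
qed

lemma no_invariant_imp_space_irreducible:
  assumes "\<not> has_invariant_subspace (transpose A)"
  shows "space_irreducible psd_cone (lyapunov A)"
  unfolding space_irreducible_def
proof (intro allI impI)
  fix F assume "cone_face F psd_cone \<and> lyapunov A ` diff_set F \<subseteq> diff_set F"
  then have F: "convex_cone F" "F \<subseteq> psd_cone"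
    and face: "\<And>b c. b + c \<in> F \<Longrightarrow> b \<in> psd_cone \<Longrightarrow> c \<in> psd_cone \<Longrightarrow> b \<in> F"
    and inv: "lyapunov A ` diff_set F \<subseteq> diff_set F"
    unfolding cone_face_def by blast+
  define N where "N = {v. \<forall>X\<in>F. X *v v = 0}"
  have "subspace N"
    by (auto simp: N_def subspace_def matrix_vector_right_distrib matrix_vector_mult_scaleR)
  moreover have "transpose A *v v \<in> N" if v: "v \<in> N" for v
  proof -
    have "X *v (transpose A *v v) = 0" if X: "X \<in> F" for X
    proof -
      have "X \<in> diff_set F"
        using X convex_cone_contains_0[OF F(1)] unfolding diff_set_def by force
      then have "lyapunov A X \<in> diff_set F" using inv by blast
      then have "lyapunov A X *v v = 0"
        using v by (auto simp: diff_set_def N_def matrix_vector_mult_diff_rdistrib)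
      then show ?thesis
        using v X by (simp add: lyapunov_def matrix_vector_mult_add_rdistrib
            matrix_vector_mul_assoc[symmetric] N_def)
    qed
    then show ?thesis by (simp add: N_def)
  qed
  ultimately consider "N = {0}" | "N = UNIV"
    using assms unfolding has_invariant_subspace_def by blast
  then show "F = {0} \<or> F = psd_cone"
  proof cases
    case 1
    obtain X where X: "X \<in> F" "\<And>v. X *v v = 0 \<Longrightarrow> \<forall>Y\<in>F. Y *v v = 0"
      using face_common_kernel[OF F] by blast
    then have def: "v = 0" if "X *v v = 0" for v
      using that 1 unfolding N_def by blast
    have "Y \<in> F" if Y: "Y \<in> psd_cone" for Y
    proof -
      obtain t where t: "0 \<le> t" "t *\<^sub>R X - Y \<in> psd_cone"
        using positive_definite_dominates[OF _ def Y] X F by blast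
      have "Y + (t *\<^sub>R X - Y) \<in> F"
        using X t F by (simp add: convex_cone_scaleR)
      then show ?thesis using face Y t by blast
    qed
    then show ?thesis using F by blast
  next
    case 2
    then have "X = 0" if "X \<in> F" for X
      using that unfolding N_def by (auto simp: matrix_eq)
    then show ?thesis using convex_cone_contains_0[OF F(1)] by blast
  qed
qed

lemma space_irreducible_iff:
  "space_irreducible psd_cone (lyapunov A) \<longleftrightarrow> \<not> has_invariant_subspace A"
  using space_irreducible_imp_no_invariant no_invariant_imp_space_irreducible
    has_invariant_subspace_transpose by blast

section \<open>Orthogonal similarity and block triangular form\<close>

text \<open>
  The enumeration only serves to place the index set \<open>S\<close> of the first block in front.
\<close>

lemma irreducible_matrix_iff:
  fixes A :: "real ^ 'n ^ 'n"
  shows "irreducible_matrix A \<longleftrightarrow>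
     \<not> (\<exists>S. S \<noteq> {} \<and> S \<noteq> UNIV \<and> (\<forall>i\<in>-S. \<forall>j\<in>S. A $ i $ j = 0))"
proof -
  have block: "\<exists>S. S \<noteq> {} \<and> S \<noteq> UNIV \<and> (\<forall>i\<in>-S. \<forall>j\<in>S. A $ i $ j = 0)"
    if p: "bij_betw p {..<CARD('n)} UNIV" and k: "0 < k" "k < CARD('n)"
      and z: "\<forall>i\<in>{k..<CARD('n)}. \<forall>j\<in>{..<k}. A $ p i $ p j = 0" for p :: "nat \<Rightarrow> 'n" and k
  proof (intro exI conjI ballI)
    have inj: "inj_on p {..<CARD('n)}" and sur: "p ` {..<CARD('n)} = UNIV"
      using p by (auto simp: bij_betw_def)
    show "p ` {..<k} \<noteq> {}" using k by auto
    have "p k \<notin> p ` {..<k}" using inj_onD[OF inj] k by fastforce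
    then show "p ` {..<k} \<noteq> UNIV" by blast
    fix i j assume i: "i \<in> - p ` {..<k}" and j: "j \<in> p ` {..<k}"
    obtain a where "a < CARD('n)" "i = p a" using sur by (metis UNIV_I imageE lessThan_iff)
    moreover have "k \<le> a" using calculation i by (metis ComplD imageI lessThan_iff not_le)
    ultimately show "A $ i $ j = 0" using z j by auto
  qed
  have enum: "\<exists>(p :: nat \<Rightarrow> 'n) k. bij_betw p {..<CARD('n)} UNIV \<and> 0 < k \<and> k < CARD('n) \<and>
          (\<forall>i\<in>{k..<CARD('n)}. \<forall>j\<in>{..<k}. A $ p i $ p j = 0)"
    if S: "S \<noteq> {}" "S \<noteq> UNIV" and z: "\<forall>i\<in>-S. \<forall>j\<in>S. A $ i $ j = 0" for S
  proof -
    define k where "k = card S"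
    have k: "0 < k" using S by (simp add: k_def card_gt_0_iff)
    have k': "k < CARD('n)" using S unfolding k_def by (intro psubset_card_mono) auto
    have cC: "card (- S) = CARD('n) - k" by (simp add: k_def card_Diff_subset Compl_eq_Diff_UNIV)
    obtain f where f: "bij_betw f {..<k} S"
      using finite_same_card_bij[of "{..<k}" S] by (auto simp: k_def)
    obtain g where g: "bij_betw g {k..<CARD('n)} (- S)"
      using finite_same_card_bij[of "{k..<CARD('n)}" "- S"] cC by auto
    define p where "p i = (if i < k then f i else g i)" for i
    have pf: "bij_betw p {..<k} S"
      using f by (subst bij_betw_cong[of _ _ f]) (auto simp: p_def)
    have pg: "bij_betw p {k..<CARD('n)} (- S)"
      using g by (subst bij_betw_cong[of _ _ g]) (auto simp: p_def)
    have "bij_betw p ({..<k} \<union> {k..<CARD('n)}) (S \<union> - S)"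
      by (rule bij_betw_combine[OF pf pg]) auto
    moreover have "{..<k} \<union> {k..<CARD('n)} = {..<CARD('n)}" using k' by auto
    ultimately have "bij_betw p {..<CARD('n)} UNIV" by simp
    moreover have "\<forall>i\<in>{k..<CARD('n)}. \<forall>j\<in>{..<k}. A $ p i $ p j = 0"
      using z pf pg by (auto dest!: bij_betwE)
    ultimately show ?thesis using k k' by blast
  qed
  show ?thesis
    unfolding irreducible_matrix_def
    by (rule arg_cong[of _ _ Not], rule iffI; elim exE conjE) (rule block enum; assumption)+
qed

lemma adapted_orthogonal_matrix:
  fixes W :: "(real ^ 'n) set"
  assumes "subspace W"
  obtains U :: "real ^ 'n ^ 'n" and S where "orthogonal_matrix U"
    "span ((\<lambda>j. column j U) ` S) = W" "\<forall>i\<in>-S. column i U \<in> W\<^sup>\<bottom>"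
proof -
  obtain B where B: "B \<subseteq> W" "pairwise orthogonal B" "\<And>x. x \<in> B \<Longrightarrow> norm x = 1" "span B = W"
    using orthonormal_basis_subspace[OF assms] by metis
  obtain C where C: "C \<subseteq> W\<^sup>\<bottom>" "pairwise orthogonal C" "\<And>x. x \<in> C \<Longrightarrow> norm x = 1" "span C = W\<^sup>\<bottom>"
    using orthonormal_basis_subspace[OF subspace_orthogonal_comp] by metis
  have BC: "orthogonal x y" if "x \<in> B" "y \<in> C" for x y
    using that B(1) C(1) by (auto simp: orthogonal_comp_def)
  have orth: "pairwise orthogonal (B \<union> C)"
  proof (rule pairwiseI)
    fix x y assume "x \<in> B \<union> C" "y \<in> B \<union> C" "x \<noteq> y"
    then show "orthogonal x y"
      using pairwiseD[OF B(2), of x y] pairwiseD[OF C(2), of x y] BC[of x y] BC[of y x]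
        orthogonal_commute[of x y] by blast
  qed
  have norm1: "norm x = 1" if "x \<in> B \<union> C" for x using that B C by blast
  then have ind: "independent (B \<union> C)"
    using pairwise_orthogonal_independent[OF orth] by force
  have "span (B \<union> C) = W + W\<^sup>\<bottom>"
    unfolding span_Un B(4) C(4) by (auto simp: set_plus_def)
  then have "span (B \<union> C) = UNIV"
    using subspace_sum_orthogonal_comp[OF assms] by simp
  then have card: "card (B \<union> C) = CARD('n)"
    using ind by (metis dim_UNIV dim_span_eq_card_independent DIM_cart DIM_real mult.right_neutral)
  have fin: "finite (B \<union> C)" using ind by (rule independent_imp_finite)
  obtain g :: "'n \<Rightarrow> real ^ 'n" where g: "bij_betw g UNIV (B \<union> C)"
    using finite_same_card_bij[of "UNIV :: 'n set" "B \<union> C"] fin card by auto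
  define U :: "real ^ 'n ^ 'n" where "U = (\<chi> i j. g j $ i)"
  have col: "column j U = g j" for j by (simp add: U_def column_def vec_eq_iff)
  have gin: "g j \<in> B \<union> C" for j using g by (auto dest: bij_betwE)
  have ginj: "g i \<noteq> g j" if "i \<noteq> j" for i j using g that by (auto simp: bij_betw_def inj_on_def)
  have "orthogonal_matrix U"
    using orth norm1 gin ginj
    by (simp add: orthogonal_matrix_orthonormal_columns col pairwise_def)
  moreover have "g ` (g -` B) = B" using g by (auto simp: bij_betw_def)
  then have "span ((\<lambda>j. column j U) ` (g -` B)) = W" using B by (simp add: col)
  moreover have "\<forall>i\<in>-(g -` B). column i U \<in> W\<^sup>\<bottom>" using gin C(1) by (auto simp: col)
  ultimately show thesis using that by blast
qed

lemma orthogonal_similarity_entry: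
  fixes A U :: "real ^ 'n ^ 'n"
  shows "(transpose U ** A ** U) $ i $ j = column i U \<bullet> (A *v column j U)"
proof -
  have "(transpose U ** A ** U) $ i $ j = ((transpose U ** A ** U) *v axis j 1) \<bullet> axis i 1"
    by (simp only: matrix_vector_mult_basis) (simp add: column_def inner_axis)
  also have "\<dots> = axis i 1 \<bullet> (transpose U *v (A *v (U *v axis j 1)))"
    by (simp only: matrix_vector_mul_assoc[symmetric] inner_commute)
  also have "\<dots> = (U *v axis i 1) \<bullet> (A *v (U *v axis j 1))"
    by (simp only: inner_transpose_mult transpose_transpose)
  finally show ?thesis
    by (simp only: matrix_vector_mult_basis)
qed

lemma invariant_subspace_imp_reducible:
  assumes "has_invariant_subspace A"
  obtains U where "orthogonal_matrix U" "\<not> irreducible_matrix (transpose U ** A ** U)"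
proof -
  obtain W where W: "subspace W" "W \<noteq> {0}" "W \<noteq> UNIV" "\<forall>w\<in>W. A *v w \<in> W"
    using assms unfolding has_invariant_subspace_def by blast
  obtain U S where U: "orthogonal_matrix U" "span ((\<lambda>j. column j U) ` S) = W"
    "\<forall>i\<in>-S. column i U \<in> W\<^sup>\<bottom>"
    using adapted_orthogonal_matrix[OF W(1)] by blast
  have "S \<noteq> {}" using U(2) W(2) by auto
  moreover have "S \<noteq> UNIV"
  proof
    assume "S = UNIV"
    then have "columns U = (\<lambda>j. column j U) ` S" by (auto simp: columns_def)
    moreover have "span (columns U) = UNIV"
      using U(1) matrix_right_invertible_span_columns[of U] unfolding orthogonal_matrix_def
      by (auto simp: span_vec_eq)
    ultimately show False using U(2) W(3) by simp
  qed
  moreover have "(transpose U ** A ** U) $ i $ j = 0" if "i \<in> -S" "j \<in> S" for i j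
  proof -
    \<comment> \<open>The entry is the inner product of a vector of \<open>W\<close> with one orthogonal to \<open>W\<close>.\<close>
    have "A *v column j U \<in> W" using W(4) U(2) that by (blast intro: span_base)
    then show ?thesis
      using U(3) that
      by (auto simp: orthogonal_similarity_entry orthogonal_comp_def orthogonal_def inner_commute[of "column i U"])
  qed
  ultimately have "\<not> irreducible_matrix (transpose U ** A ** U)"
    unfolding irreducible_matrix_iff by blast
  with U(1) that show thesis by blast
qed

lemma reducible_imp_invariant_subspace:
  fixes A U :: "real ^ 'n ^ 'n"
  assumes U: "orthogonal_matrix U" and red: "\<not> irreducible_matrix (transpose U ** A ** U)"
  shows "has_invariant_subspace A"
proof -
  define B where "B = transpose U ** A ** U"
  obtain S where S: "S \<noteq> {}" "S \<noteq> UNIV" "\<And>i j. i \<notin> S \<Longrightarrow> j \<in> S \<Longrightarrow> B $ i $ j = 0"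
    using red unfolding irreducible_matrix_iff B_def by auto
  define T :: "(real ^ 'n) set" where "T = {x. \<forall>i. i \<notin> S \<longrightarrow> x $ i = 0}"
  have UU: "transpose U ** U = mat 1" "U ** transpose U = mat 1"
    using U by (auto simp: orthogonal_matrix_def)
  \<comment> \<open>The coordinate subspace \<open>T\<close> is invariant under \<open>B\<close>, so its image under \<open>U\<close> is invariant under \<open>A\<close>.\<close>
  have UB: "A *v (U *v x) = U *v (B *v x)" for x
    unfolding B_def using UU
    by (metis matrix_mul_assoc matrix_mul_lid matrix_vector_mul_assoc)
  have T: "subspace T" by (auto simp: T_def subspace_def)
  have BT: "B *v x \<in> T" if "x \<in> T" for x
    using that S(3) unfolding T_def matrix_vector_mult_def
    by (auto intro!: sum.neutral) (metis)
  have invU: "transpose U *v (U *v x) = x" for x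
    by (simp add: matrix_vector_mul_assoc UU)
  have injU: "U *v x = U *v y \<longleftrightarrow> x = y" for x y
    by (metis invU)
  show ?thesis
    unfolding has_invariant_subspace_def
  proof (intro exI[of _ "(*v) U ` T"] conjI ballI)
    show "subspace ((*v) U ` T)" using T by (simp add: linear_subspace_image)
    obtain j where j: "j \<in> S" using S by blast
    have "axis j 1 \<in> T" using j by (auto simp: T_def axis_def)
    moreover have "U *v axis j 1 \<noteq> 0" using injU[of "axis j 1" 0] by simp
    ultimately show "(*v) U ` T \<noteq> {0}" by blast
    obtain i where i: "i \<notin> S" using S by blast
    have "axis i 1 \<notin> T" using i by (auto simp: T_def axis_def)
    then have "U *v axis i 1 \<notin> (*v) U ` T" using injU by auto
    then show "(*v) U ` T \<noteq> UNIV" by blast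
    fix w assume "w \<in> (*v) U ` T"
    then show "A *v w \<in> (*v) U ` T" using UB BT by auto
  qed
qed

section \<open>Complex eigenvalues\<close>

abbreviation complexify :: "real ^ 'n ^ 'm \<Rightarrow> complex ^ 'n ^ 'm" where
  "complexify A \<equiv> \<chi> i j. complex_of_real (A $ i $ j)"

text \<open>
  Here \<open>x\<close> and \<open>y\<close> are the real and imaginary parts of the eigenvector.
\<close>

lemma complex_eigenvalue_iff:
  fixes A :: "real ^ 'n ^ 'n"
  shows "complex_eigenvalue A z \<longleftrightarrow>
    (\<exists>x y. (x \<noteq> 0 \<or> y \<noteq> 0) \<and> A *v x = Re z *\<^sub>R x - Im z *\<^sub>R y \<and> A *v y = Im z *\<^sub>R x + Re z *\<^sub>R y)"
    (is "_ \<longleftrightarrow> (\<exists>x y. ?P x y)")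
proof -
  define C :: "real ^ 'n \<Rightarrow> real ^ 'n \<Rightarrow> complex ^ 'n" where "C x y = (\<chi> i. Complex (x $ i) (y $ i))" for x y
  have "?P x y \<longleftrightarrow> C x y \<noteq> 0 \<and> complexify A *v C x y = z *s C x y" for x y
    by (auto simp: C_def vec_eq_iff complex_eq_iff matrix_vector_mult_def all_conj_distrib add.commute)
  moreover have "\<exists>x y. v = C x y" for v
    by (rule exI[of _ "\<chi> i. Re (v $ i)"], rule exI[of _ "\<chi> i. Im (v $ i)"])
       (simp add: C_def vec_eq_iff)
  ultimately show ?thesis unfolding complex_eigenvalue_def by metis
qed

lemma complex_eigenvalue_cnj: "complex_eigenvalue A z \<Longrightarrow> complex_eigenvalue A (cnj z)"
  unfolding complex_eigenvalue_iff
proof (elim exE conjE)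
  fix x y
  assume xy: "x \<noteq> 0 \<or> y \<noteq> 0" "A *v x = Re z *\<^sub>R x - Im z *\<^sub>R y"
    "A *v y = Im z *\<^sub>R x + Re z *\<^sub>R y"
  have "A *v (- y) = - (A *v y)"
    using matrix_vector_mult_scaleR[of A "- 1" y] by simp
  with xy show "\<exists>x y. (x \<noteq> 0 \<or> y \<noteq> 0) \<and> A *v x = Re (cnj z) *\<^sub>R x - Im (cnj z) *\<^sub>R y \<and>
      A *v y = Im (cnj z) *\<^sub>R x + Re (cnj z) *\<^sub>R y"
    by (intro exI[of _ x] exI[of _ "- y"]) simp
qed

text \<open>
  The value \<open>p(M) v\<close> of the polynomial \<open>p\<close> in the matrix \<open>M\<close>, applied to \<open>v\<close>.
\<close>

definition poly_action :: "'a::field ^ 'n ^ 'n \<Rightarrow> 'a ^ 'n \<Rightarrow> 'a poly \<Rightarrow> 'a ^ 'n" where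
  "poly_action M v p = (\<Sum>i\<le>degree p. coeff p i *s ((*v) M ^^ i) v)"

lemma poly_action_bound:
  assumes "degree p \<le> n"
  shows "poly_action M v p = (\<Sum>i\<le>n. coeff p i *s ((*v) M ^^ i) v)"
  unfolding poly_action_def using assms
  by (intro sum.mono_neutral_left) (auto simp: coeff_eq_0)

lemma poly_action_linear_factor:
  "poly_action M v ([:- z, 1:] * q) = M *v poly_action M v q - z *s poly_action M v q"
proof -
  let ?f = "\<lambda>i. ((*v) M ^^ i) v"
  define n where "n = degree q"
  have "[:- z, 1:] * q = pCons 0 q - smult z q" by simp
  moreover have "degree (pCons 0 q - smult z q) \<le> Suc n"
    by (intro degree_diff_le) (auto simp: n_def degree_pCons_le intro: le_trans[OF degree_smult_le])
  ultimately have "poly_action M v ([:- z, 1:] * q)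
      = (\<Sum>i\<le>Suc n. coeff (pCons 0 q - smult z q) i *s ?f i)"
    using poly_action_bound by metis
  also have "\<dots> = (\<Sum>i\<le>Suc n. coeff (pCons 0 q) i *s ?f i) - (\<Sum>i\<le>Suc n. z *s (coeff q i *s ?f i))"
    by (simp add: sum_subtractf vector_sub_rdistrib vector_smult_assoc)
  also have "(\<Sum>i\<le>Suc n. coeff (pCons 0 q) i *s ?f i) = M *v poly_action M v q"
    by (simp add: sum.atMost_Suc_shift poly_action_def n_def vec.linear_sum[OF matrix_vector_mul_linear_gen]
        vec.linear_scale[OF matrix_vector_mul_linear_gen] del: sum.atMost_Suc)
  also have "(\<Sum>i\<le>Suc n. z *s (coeff q i *s ?f i)) = z *s poly_action M v q"
    using poly_action_bound[of q "Suc n" M v]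
    by (simp add: vec.scale_sum_right n_def del: sum.atMost_Suc)
  finally show ?thesis .
qed

text \<open>
  The \<open>n + 1\<close> vectors \<open>v, M v, \<dots>, M\<^sup>n v\<close> are linearly dependent. Equal vectors among them give a
  dependence too, but have to be treated separately, since dependence is a property of sets.
\<close>

lemma annihilating_poly_exists:
  fixes M :: "'a::field ^ 'n ^ 'n"
  shows "\<exists>p. p \<noteq> 0 \<and> poly_action M v p = 0"
proof -
  let ?n = "CARD('n)"
  let ?f = "\<lambda>i. ((*v) M ^^ i) v"
  have "\<exists>c. (\<exists>i\<le>?n. c i \<noteq> 0) \<and> (\<Sum>i\<le>?n. c i *s ?f i) = 0"
  proof (cases "inj_on ?f {..?n}")
    case True
    then have "card (?f ` {..?n}) = Suc ?n" by (simp add: card_image)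
    then have "vec.dependent (?f ` {..?n})"
      using vec.independent_bound_general[of "?f ` {..?n}"] vec.dim_subset_UNIV[of "?f ` {..?n}"]
      by (auto simp: vec.dimension_def vec.dim_UNIV card_cart_basis)
    then obtain u where u: "\<exists>w\<in>?f ` {..?n}. u w \<noteq> 0" "(\<Sum>w\<in>?f ` {..?n}. u w *s w) = 0"
      by (auto simp: vec.dependent_finite)
    then have "(\<Sum>i\<le>?n. u (?f i) *s ?f i) = 0"
      using sum.reindex[OF True, of "\<lambda>w. u w *s w"] by simp
    with u(1) show ?thesis by (intro exI[of _ "\<lambda>i. u (?f i)"]) auto
  next
    case False
    then obtain i j where ij: "i \<le> ?n" "j \<le> ?n" "i \<noteq> j" "?f i = ?f j"
      by (auto simp: inj_on_def)
    let ?c = "\<lambda>k. if k = i then 1 else if k = j then - 1 else 0 :: 'a"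
    have "(\<Sum>k\<le>?n. ?c k *s ?f k) = (\<Sum>k\<in>{i, j}. ?c k *s ?f k)"
      using ij by (intro sum.mono_neutral_right) auto
    also have "\<dots> = 0" using ij by simp
    finally show ?thesis using ij by (intro exI[of _ ?c]) auto
  qed
  then obtain c i where c: "i \<le> ?n" "c i \<noteq> 0" "(\<Sum>i\<le>?n. c i *s ?f i) = 0" by blast
  define p where "p = (\<Sum>i\<le>?n. monom (c i) i)"
  have coeff: "coeff p k = (if k \<le> ?n then c k else 0)" for k
    by (simp add: p_def coeff_sum)
  have "p \<noteq> 0" using coeff[of i] c by auto
  moreover have "degree p \<le> ?n" by (rule degree_le) (simp add: coeff)
  then have "poly_action M v p = 0"
    using c by (simp add: poly_action_bound coeff)
  ultimately show ?thesis by blast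
qed

text \<open>
  Take a nonzero \<open>p\<close> of least degree with \<open>p(M) v = 0\<close> and split off a root \<open>z\<close> of \<open>p\<close>. By
  minimality the cofactor \<open>q\<close> gives a nonzero vector \<open>q(M) v\<close>, and \<open>M - z\<close> annihilates it.
\<close>

lemma complex_matrix_has_eigenvector:
  fixes M :: "complex ^ 'n ^ 'n"
  obtains w z where "w \<noteq> 0" "M *v w = z *s w"
proof -
  define v :: "complex ^ 'n" where "v = axis undefined 1"
  have v: "v \<noteq> 0" by (simp add: v_def axis_eq_0_iff)
  obtain p where p: "p \<noteq> 0" "poly_action M v p = 0"
    and least: "\<And>q. q \<noteq> 0 \<Longrightarrow> poly_action M v q = 0 \<Longrightarrow> degree p \<le> degree q"
    using ex_has_least_nat[of "\<lambda>p. p \<noteq> 0 \<and> poly_action M v p = 0" _ degree] annihilating_poly_exists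
    by metis
  have "degree p \<noteq> 0"
  proof
    assume "degree p = 0"
    then obtain c where "p = [:c:]" by (rule degree_eq_zeroE)
    with p v show False by (simp add: poly_action_def)
  qed
  then have "\<not> constant (poly p)" by (simp add: constant_degree)
  then obtain z where "poly p z = 0" using fundamental_theorem_of_algebra by blast
  then obtain q where q: "p = [:- z, 1:] * q" by (auto simp: poly_eq_0_iff_dvd)
  then have "q \<noteq> 0" using p by auto
  then have "degree p = Suc (degree q)" unfolding q by (subst degree_mult_eq) auto
  then have "poly_action M v q \<noteq> 0" using least[OF \<open>q \<noteq> 0\<close>] by auto
  moreover have "M *v poly_action M v q = z *s poly_action M v q"
    using p(2) unfolding q poly_action_linear_factor by simp
  ultimately show thesis using that by blast
qed

section \<open>Invariant subspaces of small dimension\<close>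

lemma no_invariant_imp_nonreal_eigenvalue:
  fixes A :: "real ^ 'n ^ 'n"
  assumes n: "CARD('n) > 1" and irr: "\<not> has_invariant_subspace A"
  shows "CARD('n) = 2 \<and> (\<exists>z. Im z \<noteq> 0 \<and> complex_eigenvalue A z)"
proof -
  obtain z where z: "complex_eigenvalue A z"
    using complex_matrix_has_eigenvector unfolding complex_eigenvalue_def by blast
  then obtain x y where xy: "x \<noteq> 0 \<or> y \<noteq> 0" "A *v x = Re z *\<^sub>R x - Im z *\<^sub>R y"
    "A *v y = Im z *\<^sub>R x + Re z *\<^sub>R y"
    unfolding complex_eigenvalue_iff by blast
  \<comment> \<open>A nonzero invariant span is everything, which bounds the dimension by the number of generators.\<close>
  have full: "CARD('n) \<le> card S"
    if "finite S" "\<exists>s\<in>S. s \<noteq> 0" "\<forall>s\<in>S. A *v s \<in> span S" for S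
  proof -
    have "A *v w \<in> span S" if "w \<in> span S" for w
      using that
    proof (induction rule: span_induct_alt)
      case base then show ?case by (simp add: span_zero)
    next
      case (step c s w)
      then show ?case
        using \<open>\<forall>s\<in>S. A *v s \<in> span S\<close>
        by (simp add: matrix_vector_right_distrib matrix_vector_mult_scaleR span_add span_scale)
    qed
    moreover have "span S \<noteq> {0}" using that(2) span_base by blast
    ultimately have "span S = UNIV"
      using irr subspace_span unfolding has_invariant_subspace_def by blast
    then show ?thesis using dim_le_card'[OF \<open>finite S\<close>] by (metis dim_UNIV dim_span DIM_cart DIM_real mult.right_neutral)
  qed
  have "CARD('n) \<le> card {x, y}"
    using xy(1) by (intro full) (auto simp: xy(2,3) intro: span_add span_diff span_scale span_base)
  then have "CARD('n) = 2"
    using n card_insert_le_m1 by (cases "x = y") auto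
  moreover have "Im z \<noteq> 0"
  proof
    assume "Im z = 0"
    moreover obtain s where "s \<noteq> 0" "s = x \<or> s = y" using xy by blast
    ultimately have "CARD('n) \<le> card {s}"
      using xy(2,3) by (intro full) (auto simp: span_singleton)
    then show False using n by simp
  qed
  ultimately show ?thesis using z by blast
qed

text \<open>
  The equations say that the \<open>2 \<times> 2\<close> matrix with rows \<open>(a, -b)\<close> and \<open>(b, a)\<close>, which is multiplication
  by \<open>a + b \<i>\<close>, maps \<open>(s, t)\<close> to its multiple by the real number \<open>\<mu>\<close>.
\<close>

lemma rotation_scaling_no_real_eigenvalue:
  fixes s t :: real
  assumes "b \<noteq> 0" "\<mu> * s = a * s - b * t" "\<mu> * t = b * s + a * t"
  shows "s = 0" "t = 0"
proof -
  have "b * (s * s + t * t) = s * (b * s + a * t) - t * (a * s - b * t)"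
    by (simp add: algebra_simps)
  also have "\<dots> = s * (\<mu> * t) - t * (\<mu> * s)"
    by (simp add: assms)
  finally have "b * (s * s + t * t) = 0" by simp
  then show "s = 0" "t = 0" using assms(1) by (auto simp: sum_squares_eq_zero_iff)
qed

lemma invariant_line_eigenvector:
  fixes M :: "real ^ 'n ^ 'n"
  assumes n: "CARD('n) = 2" and W: "subspace W" "W \<noteq> {0}" "W \<noteq> UNIV" "\<forall>w\<in>W. M *v w \<in> W"
  obtains w \<mu> where "w \<noteq> 0" "W = span {w}" "M *v w = \<mu> *\<^sub>R w"
proof -
  obtain B where B: "B \<subseteq> W" "\<And>x. x \<in> B \<Longrightarrow> norm x = 1" "independent B" "card B = dim W" "span B = W"
    using orthonormal_basis_subspace[OF W(1)] by metis
  have "dim W < DIM(real ^ 'n)"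
    using W by (metis dim_eq_full dim_subset_UNIV le_neq_implies_less span_eq_iff)
  moreover have "dim W \<noteq> 0" using W(2) subspace_0[OF W(1)] by auto
  moreover have "DIM(real ^ 'n) = 2" using n by simp
  ultimately have "dim W = 1" by linarith
  then have "card B = 1" using B(4) by simp
  then obtain w where w: "B = {w}" by (auto simp: card_1_singleton_iff)
  have "M *v w \<in> span {w}" using W B w by auto
  then obtain \<mu> where "M *v w = \<mu> *\<^sub>R w" by (auto simp: span_singleton)
  moreover have "w \<noteq> 0" using B(2) w by force
  ultimately show thesis using that B w by blast
qed

text \<open>
  Pairing an eigenvector \<open>x + \<i> y\<close> with a real eigenvector \<open>u\<close> of \<open>A\<^sup>T\<close> spanning the orthogonal
  complement of the invariant line \<open>W\<close> shows that \<open>x\<close> and \<open>y\<close> lie in \<open>W\<close>. But on \<open>W\<close>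
  the matrix acts by a real scalar, so \<open>x = y = 0\<close>.
\<close>

lemma nonreal_eigenvalue_imp_no_invariant:
  fixes A :: "real ^ 'n ^ 'n"
  assumes n: "CARD('n) = 2" and z: "Im z \<noteq> 0" "complex_eigenvalue A z"
  shows "\<not> has_invariant_subspace A"
proof
  assume "has_invariant_subspace A"
  then obtain W where W: "subspace W" "W \<noteq> {0}" "W \<noteq> UNIV" "\<forall>w\<in>W. A *v w \<in> W"
    unfolding has_invariant_subspace_def by blast
  obtain x y where xy: "x \<noteq> 0 \<or> y \<noteq> 0" "A *v x = Re z *\<^sub>R x - Im z *\<^sub>R y"
    "A *v y = Im z *\<^sub>R x + Re z *\<^sub>R y"
    using z unfolding complex_eigenvalue_iff by blast
  obtain w \<nu> where w: "w \<noteq> 0" "W = span {w}" "A *v w = \<nu> *\<^sub>R w"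
    using invariant_line_eigenvector[OF n W] by blast
  obtain u \<mu> where u: "u \<noteq> 0" "W\<^sup>\<bottom> = span {u}" "transpose A *v u = \<mu> *\<^sub>R u"
    using invariant_line_eigenvector[OF n subspace_orthogonal_comp orthogonal_comp_proper[OF W(1-3)]]
      orthogonal_comp_invariant[OF W(4)] by metis
  have uA: "\<mu> * (u \<bullet> s) = u \<bullet> (A *v s)" for s
    by (simp add: inner_transpose_mult u)
  have "\<mu> * (u \<bullet> x) = Re z * (u \<bullet> x) - Im z * (u \<bullet> y)"
    "\<mu> * (u \<bullet> y) = Im z * (u \<bullet> x) + Re z * (u \<bullet> y)"
    by (simp_all add: uA xy inner_diff_right inner_add_right)
  then have "u \<bullet> x = 0" "u \<bullet> y = 0"
    using rotation_scaling_no_real_eigenvalue[OF z(1)] by blast+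
  then have "x \<in> (span {u})\<^sup>\<bottom>" "y \<in> (span {u})\<^sup>\<bottom>"
    by (auto simp: orthogonal_comp_def orthogonal_def span_singleton)
  then have "x \<in> span {w}" "y \<in> span {w}"
    using u(2) w(2) orthogonal_comp_self[OF W(1)] by auto
  then obtain s t where st: "x = s *\<^sub>R w" "y = t *\<^sub>R w" by (auto simp: span_singleton)
  have "(\<nu> * s) *\<^sub>R w = (Re z * s - Im z * t) *\<^sub>R w" "(\<nu> * t) *\<^sub>R w = (Im z * s + Re z * t) *\<^sub>R w"
    using xy(2,3) by (simp_all add: st matrix_vector_mult_scaleR w algebra_simps)
  then have "s = 0" "t = 0"
    using rotation_scaling_no_real_eigenvalue[OF z(1), of \<nu> s "Re z" t] w(1) by auto
  with st xy(1) show False by simp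
qed

theorem mainTheorem7:
  fixes A :: "real ^ 'n ^ 'n"
  assumes "CARD('n) > 1"
  shows "(space_irreducible psd_cone (lyapunov A) \<longleftrightarrow>
            (\<forall>U :: real ^ 'n ^ 'n. orthogonal_matrix U \<longrightarrow>
               irreducible_matrix (transpose U ** A ** U)))
       \<and> (space_irreducible psd_cone (lyapunov A) \<longleftrightarrow>
            CARD('n) = 2 \<and>
            (\<exists>z. Im z \<noteq> 0 \<and> complex_eigenvalue A z \<and> complex_eigenvalue A (cnj z)))"
  unfolding space_irreducible_iff
  using invariant_subspace_imp_reducible reducible_imp_invariant_subspace
    no_invariant_imp_nonreal_eigenvalue[OF assms] nonreal_eigenvalue_imp_no_invariant
    complex_eigenvalue_cnj
  by metis

end
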